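(* (a) If $k$ is odd, $k=2\ell-1$ with $\ell\ge 2$, there exists a chordal ring mixed graph $CRM(n,c)$ with diameter $k$, order $n=2\ell^2=\frac12(k+1)^2$, and chordal length $c=2\ell-1=k$. (b) If $k$ is even, with $k\equiv 0 \pmod 4$, $k=2\ell=4t$ with $t\ge 1$, there exists a chordal ring mixed graph $CRM(n,c)$ with diameter $k$, order $n=8t^2+2=\frac12k^2+2$, and chordal length $c=(2t-1)^2+2t=\left(\frac k2-1\right)^2+\frac k2$. (c1) If $k$ is even, $k\equiv 6\pmod 8$, $k=2\ell=8t-2$ with $t\ge 1$, there exists a chordal ring mixed graph $CRM(n,c)$ with diameter $k$, order $n=2(4t-1)(4t-2)+4=k\left(\frac k2-1\right)+4$, and chordal length $c=8t^2-8t+3=\frac18(k+2)^2-k+1$. (c2) If $k$ is even, $k\equiv 2\pmod 8$, $k=2\ell=8t-6$ with $t\ge 1$, there exists a chordal ring mixed graph $CRM(n,c)$ with diameter $k$, order $n=2(4t-3)(4t-4)+4=k\left(\frac k2-1\right)+4$, and chordal length $c=24t^2-44t+23=\frac38(k+6)^2-\frac{11}{2}k-10$.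
   Context: A mixed graph may contain undirected edges and directed edges (arcs). The distance from $u$ to $v$ is the length of a shortest path from $u$ to $v$, where edges may be traversed in both directions and arcs only along their orientation; the diameter is the maximum distance over all ordered pairs of vertices. The order is the number of vertices. Let $n\ge 2$ be an even number and let $c<n$ be an odd number. The chordal ring mixed graph $CRM(n,c)$ has vertex set $\mathbb{Z}_n$ (all arithmetic modulo $n$), arcs $i\to i+1$ for every $i\in\mathbb{Z}_n$ (forming a directed cycle), and edges $i\sim i+c$ for every odd $i$ (the chords). The number $c$ is called the chordal length.
   Formalization: In (c2) the range is t ≥ 2 instead of t ≥ 1, because for t = 1 the claim (k = 2, n = 4, c = 3) is false: in CRM(4,3) the distance from 0 to 3 is 3, so the diameter is not 2. *)

theory Defs
  imports Complex_Main "HOL-Library.Extended_Nat"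
begin

record 'a mixed_graph =
  mverts :: "'a set"
  medges :: "'a set set"
  marcs :: "('a \<times> 'a) set"

definition mstep :: "'a mixed_graph \<Rightarrow> 'a \<Rightarrow> 'a \<Rightarrow> bool" where
  "mstep G u v \<longleftrightarrow> {u, v} \<in> medges G \<or> (u, v) \<in> marcs G"

definition mpath :: "'a mixed_graph \<Rightarrow> 'a \<Rightarrow> 'a list \<Rightarrow> 'a \<Rightarrow> bool" where
  "mpath G u p v \<longleftrightarrow> p \<noteq> [] \<and> hd p = u \<and> last p = v \<and> set p \<subseteq> mverts G \<and>
     distinct p \<and> successively (mstep G) p"

text \<open>A path is the list of its vertices, so its length is one less than that of the list.
  The distance is \<open>\<infinity>\<close> if there is no path.\<close>

definition mdist :: "'a mixed_graph \<Rightarrow> 'a \<Rightarrow> 'a \<Rightarrow> enat" where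
  "mdist G u v = (INF p \<in> {p. mpath G u p v}. enat (length p - 1))"

definition mdiameter :: "'a mixed_graph \<Rightarrow> enat" where
  "mdiameter G = (SUP (u, v) \<in> mverts G \<times> mverts G. mdist G u v)"

definition morder :: "'a mixed_graph \<Rightarrow> nat" where
  "morder G = card (mverts G)"

text \<open>The integers modulo \<open>n\<close> are represented by their residues \<open>0, \<dots>, n - 1\<close>. The definition
  of \<open>CRM n c\<close> is only meant for parameters satisfying \<open>CRM_params n c\<close>; since \<open>n\<close> is then even,
  the parity of a residue class is well defined.\<close>

definition CRM_params :: "nat \<Rightarrow> nat \<Rightarrow> bool" where
  "CRM_params n c \<longleftrightarrow> 2 \<le> n \<and> even n \<and> odd c \<and> c < n"

definition CRM :: "nat \<Rightarrow> nat \<Rightarrow> nat mixed_graph" where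
  "CRM n c =
    \<lparr>mverts = {..<n},
     medges = {{i, (i + c) mod n} | i. i < n \<and> odd i},
     marcs = {(i, (i + 1) mod n) | i. i < n}\<rparr>"

text \<open>The formulas for \<open>k = 8t - 6\<close> give \<open>k = 2\<close>, \<open>n = 4\<close>, \<open>c = 3\<close> at \<open>t = 1\<close>. The following shows
  that no chordal ring mixed graph of order 4 has diameter 2 (for \<open>c = 3\<close> the vertex 3 is too far
  from 0, for \<open>c = 1\<close> the vertex 0 is too far from 1), so that case has to start at \<open>t = 2\<close>.\<close>

lemma mstep_CRM_iff:
  "mstep (CRM n c) u v \<longleftrightarrow>
    u < n \<and> v = (u + 1) mod n \<or> u < n \<and> odd u \<and> v = (u + c) mod n \<or>
    v < n \<and> odd v \<and> u = (v + c) mod n"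
  by (auto simp: mstep_def CRM_def doubleton_eq_iff)

lemma mdiameter_ge_3I:
  assumes "u \<in> mverts G" "v \<in> mverts G"
    and "u \<noteq> v" "\<not> mstep G u v" "\<And>w. w \<in> mverts G \<Longrightarrow> mstep G u w \<Longrightarrow> \<not> mstep G w v"
  shows "3 \<le> mdiameter G"
proof -
  have "3 \<le> enat (length p - 1)" if p: "mpath G u p v" for p
  proof -
    have "3 \<le> length p - 1"
    proof (rule ccontr)
      assume "\<not> 3 \<le> length p - 1"
      moreover have "p \<noteq> []" using p by (simp add: mpath_def)
      ultimately consider x where "p = [x]" | x y where "p = [x, y]" | x y z where "p = [x, y, z]"
        by (metis One_nat_def Suc_le_mono diff_Suc_1 le0 length_Cons list.exhaust numeral_3_eq_3)
      then show False
        by cases (use p assms in \<open>auto simp: mpath_def\<close>)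
    qed
    then show ?thesis by (simp add: numeral_eq_enat)
  qed
  then have "3 \<le> mdist G u v"
    unfolding mdist_def by (intro INF_greatest) auto
  also have "\<dots> \<le> mdiameter G"
    unfolding mdiameter_def using assms(1,2) by (intro SUP_upper2[where i = "(u, v)"]) auto
  finally show ?thesis .
qed

lemma mdiameter_CRM_4:
  assumes "CRM_params 4 c"
  shows "3 \<le> mdiameter (CRM 4 c)"
proof -
  have less4: "w < 4 \<longleftrightarrow> w = 0 \<or> w = 1 \<or> w = 2 \<or> w = 3" for w :: nat
    by linarith
  have verts: "w \<in> mverts (CRM 4 c) \<longleftrightarrow> w = 0 \<or> w = 1 \<or> w = 2 \<or> w = 3" for w
    by (simp add: CRM_def less4)
  have "c = 1 \<or> c = 3"
    using assms by (auto simp: CRM_params_def less4)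
  then show ?thesis
  proof
    assume c: "c = 1"
    note verts = verts[unfolded c]
    show ?thesis unfolding c
    proof (rule mdiameter_ge_3I[of 1 _ 0])
      fix w assume "w \<in> mverts (CRM 4 1)" "mstep (CRM 4 1) 1 w"
      then show "\<not> mstep (CRM 4 1) w 0"
        unfolding verts by (elim disjE) (simp_all add: mstep_CRM_iff)
    qed (simp_all only: verts mstep_CRM_iff, simp_all)
  next
    assume c: "c = 3"
    note verts = verts[unfolded c]
    show ?thesis unfolding c
    proof (rule mdiameter_ge_3I[of 0 _ 3])
      fix w assume "w \<in> mverts (CRM 4 3)" "mstep (CRM 4 3) 0 w"
      then show "\<not> mstep (CRM 4 3) w 3"
        unfolding verts by (elim disjE) (simp_all add: mstep_CRM_iff)
    qed (simp_all only: verts mstep_CRM_iff, simp_all)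
  qed
qed

end

theory Submission
  imports Defs "HOL-Number_Theory.Cong"
begin

text \<open>Every step of a walk in \<open>CRM n c\<close> changes the parity, so a walk of length \<open>j\<close> that uses \<open>p\<close> chords at
  even and \<open>q\<close> chords at odd vertices ends at \<open>j - p (c + 1) + q (c - 1)\<close> from its origin, where
  \<open>p\<close> and \<open>q\<close> range independently up to half of \<open>j\<close>, rounded up or down. With \<open>n = 2 N\<close> and \<open>c = 2 b + 1\<close>
  the diameter is thus determined by how the rectangles of pairs \<open>(p, q)\<close> cover the integers modulo \<open>N\<close>
  under \<open>(p, q) \<mapsto> q b - p (b + 1)\<close>. In each family this map becomes, after multiplication by a
  unit modulo \<open>N\<close>, a positional number system: \<open>l (q - p) - q\<close> modulo \<open>l\<^sup>2\<close>, \<open>p + 2 t q\<close> modulo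
  \<open>4 t\<^sup>2 + 1\<close>, or \<open>q - (l - 1) p\<close> modulo \<open>l (l - 1) + 2\<close>. The rectangle that belongs to the diameter minus
  one covers all residues, the next smaller one misses a residue.\<close>

section \<open>Walks and distances in an arbitrary mixed graph\<close>

lemma relpowp_if_successively:
  "successively R (x # xs) \<Longrightarrow> (R ^^ length xs) x (last (x # xs))"
  by (induction xs arbitrary: x) (auto intro: relpowp_Suc_I2 simp del: relpowp.simps(2))

lemma successively_if_relpowp:
  "(R ^^ j) x y \<Longrightarrow> \<exists>xs. length xs = j \<and> last (x # xs) = y \<and> successively R (x # xs)"
proof (induction j arbitrary: x)
  case (Suc j)
  then obtain w where "R x w" "(R ^^ j) w y"
    by (meson relpowp_Suc_D2)
  moreover from this Suc.IH obtain xs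
    where "length xs = j" "last (w # xs) = y" "successively R (w # xs)" by blast
  ultimately show ?case
    by (intro exI[of _ "w # xs"]) auto
qed auto

text \<open>Cutting out the segment between two occurrences of a vertex shortens a walk and keeps
  its ends. Walks may thus replace the paths of \<open>mpath\<close>, which never repeat a
  vertex.\<close>

lemma successively_distinct:
  assumes "successively R p" "p \<noteq> []"
  shows "\<exists>q. q \<noteq> [] \<and> hd q = hd p \<and> last q = last p \<and> set q \<subseteq> set p \<and> distinct q \<and>
    length q \<le> length p \<and> successively R q"
  using assms
proof (induction p rule: length_induct)
  case (1 p)
  show ?case
  proof (cases "distinct p")
    case True
    with 1 show ?thesis by blast
  next
    case False
    then obtain xs y ys zs where p: "p = xs @ [y] @ ys @ [y] @ zs"
      using not_distinct_decomp by blast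
    define r where "r = xs @ [y] @ zs"
    have "successively R r"
      using 1(2) by (auto simp: p r_def successively_append_iff successively_Cons)
    moreover have "length r < length p" "r \<noteq> []" "hd r = hd p" "last r = last p" "set r \<subseteq> set p"
      by (auto simp: p r_def hd_append)
    ultimately show ?thesis
      using 1(1) by (metis less_imp_le_nat order_trans)
  qed
qed

lemma mdist_le_if_relpowp:
  assumes walk: "(mstep G ^^ j) u v" and u: "u \<in> mverts G"
    and closed: "\<And>a b. mstep G a b \<Longrightarrow> b \<in> mverts G"
  shows "mdist G u v \<le> enat j"
proof -
  from successively_if_relpowp[OF walk] obtain xs where xs:
    "length xs = j" "last (u # xs) = v" "successively (mstep G) (u # xs)" by blast
  have "set xs \<subseteq> mverts G" if "successively (mstep G) (w # xs)" for w xs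
    using that by (induction xs arbitrary: w) (auto dest: closed)
  with xs u have "set (u # xs) \<subseteq> mverts G" by auto
  moreover from successively_distinct[OF xs(3)] obtain q where
    "q \<noteq> []" "hd q = u" "last q = v" "set q \<subseteq> set (u # xs)" "distinct q"
    "length q \<le> length (u # xs)" "successively (mstep G) q"
    using xs(2) by auto
  ultimately have "mpath G u q v" "length q - 1 \<le> j"
    using xs(1) by (auto simp: mpath_def)
  then show ?thesis
    unfolding mdist_def by (intro INF_lower2[of q]) auto
qed

lemma mdist_ge_if_not_relpowp:
  assumes "\<And>j. j < k \<Longrightarrow> \<not> (mstep G ^^ j) u v"
  shows "enat k \<le> mdist G u v"
  unfolding mdist_def
proof (rule INF_greatest)
  fix p assume "p \<in> {p. mpath G u p v}"
  then obtain xs where "p = u # xs" "last (u # xs) = v" "successively (mstep G) (u # xs)"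
    by (cases p) (auto simp: mpath_def)
  with relpowp_if_successively[of "mstep G" u xs] have "(mstep G ^^ (length p - 1)) u v"
    by simp
  with assms show "enat k \<le> enat (length p - 1)"
    by (meson enat_ord_simps(1) not_le)
qed

section \<open>Walks in chordal rings as congruences\<close>

lemma mstep_CRM_lt: "mstep (CRM n c) u v \<Longrightarrow> 0 < n \<Longrightarrow> u < n \<and> v < n"
  by (auto simp: mstep_CRM_iff)

lemma eq_mod_iff_cong_int:
  fixes v a n :: nat
  assumes "v < n"
  shows "v = a mod n \<longleftrightarrow> [int v = int a] (mod int n)"
  using assms by (metis cong_def cong_int_iff mod_less)

text \<open>Chords are listed by their odd end, and their other end is even because \<open>n\<close>
  is even and \<open>c\<close> is odd. So exactly one chord meets each vertex: it adds
  \<open>c\<close> at an odd vertex and subtracts \<open>c\<close> at an even one.\<close>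

lemma mstep_CRM_cong:
  assumes par: "CRM_params n c" and uv: "u < n" "v < n"
  shows "mstep (CRM n c) u v \<longleftrightarrow> [int v = int u + 1] (mod int n) \<or>
    [int v = int u + (if even u then - int c else int c)] (mod int n)"
proof -
  have n: "even n" "odd c" using par by (auto simp: CRM_params_def)
  have 1: "v = (u + 1) mod n \<longleftrightarrow> [int v = int u + 1] (mod int n)"
    and 2: "v = (u + c) mod n \<longleftrightarrow> [int v = int u + int c] (mod int n)"
    using eq_mod_iff_cong_int[OF uv(2)] by (simp_all add: add.commute)
  have "u = (v + c) mod n \<longleftrightarrow> [int u = int v + int c] (mod int n)"
    using eq_mod_iff_cong_int[OF uv(1)] by simp
  also have "\<dots> \<longleftrightarrow> [int v = int u - int c] (mod int n)"
    by (subst cong_sym_eq) (simp add: cong_iff_dvd_diff algebra_simps)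
  finally have 3: "u = (v + c) mod n \<longleftrightarrow> [int v = int u - int c] (mod int n)" .
  have "even u \<longleftrightarrow> odd v" if "u = (v + c) mod n"
    using that n by (simp add: dvd_mod_iff)
  then show ?thesis
    unfolding mstep_CRM_iff 1 2 using uv 3 by auto
qed

text \<open>A walk alternates between the parities. At even vertices its steps are \<open>1\<close> and \<open>-c = 1 - (1 + c)\<close>,
  at odd vertices \<open>1\<close> and \<open>c = 1 + (c - 1)\<close>; \<open>p\<close> and \<open>q\<close> count the chords used at the
  even and at the odd ones.\<close>

lemma relpowp_mstep_CRM_iff:
  assumes par: "CRM_params n c" and "u < n" "v < n"
  shows "(mstep (CRM n c) ^^ j) u v \<longleftrightarrow>
    (\<exists>p q. p \<le> (if even u then (j + 1) div 2 else j div 2) \<and>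
       q \<le> (if even u then j div 2 else (j + 1) div 2) \<and>
       [int v = int u + int j - int p * (int c + 1) + int q * (int c - 1)] (mod int n))"
  using \<open>u < n\<close>
proof (induction j arbitrary: u)
  case 0
  with \<open>v < n\<close> have "[int v = int u] (mod int n) \<longleftrightarrow> u = v"
    by (metis cong_int_iff cong_less_modulus_unique_nat cong_refl)
  then show ?case by simp
next
  case (Suc j)
  let ?n = "int n"
  let ?step = "\<lambda>d. nat ((int u + d) mod ?n)"
  have n: "0 < n" "even n" "odd c" using par by (auto simp: CRM_params_def)
  define d where "d = (if even u then - int c else int c)"
  have step: "?step e < n" "[int (?step e) = int u + e] (mod ?n)"
    "odd e \<Longrightarrow> even (?step e) \<longleftrightarrow> odd u" for e
    using n by (auto simp: nat_less_iff cong_def even_nat_iff dvd_mod_iff)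
  have uniq: "[int w = int u + e] (mod ?n) \<longleftrightarrow> w = ?step e" if "w < n" for w e
  proof -
    from that have "[int w = int u + e] (mod ?n) \<longleftrightarrow> int w = (int u + e) mod ?n"
      by (simp add: cong_def)
    with n(1) show ?thesis by (metis nat_int int_nat_eq of_nat_0_less_iff pos_mod_sign)
  qed
  have odd_d: "odd d" using n by (simp add: d_def)
  have "(mstep (CRM n c) ^^ Suc j) u v \<longleftrightarrow>
      (\<exists>w<n. mstep (CRM n c) u w \<and> (mstep (CRM n c) ^^ j) w v)"
    using n(1) mstep_CRM_lt by (metis relpowp_Suc_D2 relpowp_Suc_I2)
  also have "\<dots> \<longleftrightarrow> (mstep (CRM n c) ^^ j) (?step 1) v \<or> (mstep (CRM n c) ^^ j) (?step d) v"
  proof -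
    have "mstep (CRM n c) u w \<longleftrightarrow> w = ?step 1 \<or> w = ?step d" if "w < n" for w
      unfolding mstep_CRM_cong[OF par Suc.prems that, folded d_def] uniq[OF that] ..
    then have "(\<exists>w<n. mstep (CRM n c) u w \<and> P w) \<longleftrightarrow> P (?step 1) \<or> P (?step d)" for P
      using step(1)[of 1] step(1)[of d] by metis
    then show ?thesis .
  qed
  \<comment> \<open>Both first steps are odd displacements, so the rest of the walk starts at the
    other parity and the bounds of the induction hypothesis are interchanged.\<close>
  also have "\<dots> \<longleftrightarrow> (\<exists>e\<in>{1, d}. \<exists>p q. p \<le> (if even u then j div 2 else (j + 1) div 2) \<and>
       q \<le> (if even u then (j + 1) div 2 else j div 2) \<and>
       [int v = int u + e + int j - int p * (int c + 1) + int q * (int c - 1)] (mod ?n))"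
  proof -
    have "[int v = int (?step e) + x] (mod ?n) \<longleftrightarrow> [int v = int u + e + x] (mod ?n)" for e x
    proof -
      have "[int (?step e) + x = int u + e + x] (mod ?n)"
        using step(2)[of e] by (rule cong_add) (rule cong_refl)
      then show ?thesis by (meson cong_sym cong_trans)
    qed
    from this[of _ "int j - int p * (int c + 1) + int q * (int c - 1)" for p q]
    have "[int v = int (?step e) + int j - int p * (int c + 1) + int q * (int c - 1)] (mod ?n) \<longleftrightarrow>
      [int v = int u + e + int j - int p * (int c + 1) + int q * (int c - 1)] (mod ?n)" for e p q
      by (simp only: add_diff_eq add.assoc[symmetric] diff_add_eq)
    with step(1,3) odd_d show ?thesis
      by (simp add: Suc.IH[OF step(1)])
  qed
  also have "\<dots> \<longleftrightarrow> (\<exists>p q. p \<le> (if even u then (Suc j + 1) div 2 else Suc j div 2) \<and>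
       q \<le> (if even u then Suc j div 2 else (Suc j + 1) div 2) \<and>
       [int v = int u + int (Suc j) - int p * (int c + 1) + int q * (int c - 1)] (mod ?n))"
    (is "?L \<longleftrightarrow> ?R")
  proof
    assume ?L
    then obtain e p q where e: "e = 1 \<or> e = d"
      and pq: "p \<le> (if even u then j div 2 else (j + 1) div 2)"
        "q \<le> (if even u then (j + 1) div 2 else j div 2)"
        "[int v = int u + e + int j - int p * (int c + 1) + int q * (int c - 1)] (mod ?n)"
      by auto
    show ?R
    proof (cases "e = 1")
      case True
      with pq show ?thesis
        by (intro exI[of _ p] exI[of _ q]) (auto simp: algebra_simps split: if_splits)
    next
      case False
      with e have "e = d" by simp
      with pq show ?thesis
        by (intro exI[of _ "if even u then p + 1 else p"] exI[of _ "if even u then q else q + 1"])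
          (auto simp: d_def algebra_simps split: if_splits)
    qed
  next
    assume ?R
    then obtain p q where
      pq: "p \<le> (if even u then (Suc j + 1) div 2 else Suc j div 2)"
        "q \<le> (if even u then Suc j div 2 else (Suc j + 1) div 2)"
        "[int v = int u + int (Suc j) - int p * (int c + 1) + int q * (int c - 1)] (mod ?n)"
      by blast
    \<comment> \<open>The order of the chords is free: if one is still due at vertices of the parity
      of \<open>u\<close>, it is taken at once, which lowers that count along with its bound. The
      arc is taken only if that count is 0 and hence meets every bound.\<close>
    show ?L
    proof (cases "(if even u then p else q) = 0")
      case True
      with pq show ?thesis
        by (intro bexI[of _ 1] exI[of _ p] exI[of _ q]) (auto simp: algebra_simps split: if_splits)
    next
      case False
      with pq show ?thesis
        by (intro bexI[of _ d] exI[of _ "if even u then p - 1 else p"]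
            exI[of _ "if even u then q else q - 1"])
          (auto simp: d_def algebra_simps of_nat_diff split: if_splits)
    qed
  qed
  finally show ?case .
qed

section \<open>Reduction of the diameter to coverings modulo \<open>N\<close>\<close>

text \<open>For \<open>n = 2 * N\<close> and \<open>c = 2 * b + 1\<close>, the displacement of the walk is its length plus \<open>2 * z\<close>.\<close>

definition covered :: "nat \<Rightarrow> int \<Rightarrow> nat \<Rightarrow> nat \<Rightarrow> int \<Rightarrow> bool" where
  "covered N b x y z \<longleftrightarrow> (\<exists>p q. p \<le> x \<and> q \<le> y \<and> [z = int q * b - int p * (b + 1)] (mod int N))"

lemma covered_mono: "covered N b x y z \<Longrightarrow> x \<le> x' \<Longrightarrow> y \<le> y' \<Longrightarrow> covered N b x' y' z"
  unfolding covered_def using order_trans by blast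

lemma cong_double_iff: "[2 * x = 2 * y] (mod 2 * n) \<longleftrightarrow> [x = y] (mod n)" for x y n :: int
proof -
  have "2 * n dvd 2 * x - 2 * y \<longleftrightarrow> 2 * n dvd 2 * (x - y)" by (simp add: right_diff_distrib)
  also have "\<dots> \<longleftrightarrow> (2 :: int) = 0 \<or> n dvd x - y" by (rule dvd_mult_cancel_left)
  finally show ?thesis by (simp add: cong_iff_dvd_diff)
qed

text \<open>With \<open>c = 2 * b + 1\<close> the corrections \<open>c + 1\<close> and
  \<open>c - 1\<close> are \<open>2 * (b + 1)\<close> and \<open>2 * b\<close>, so a factor 2
  cancels against the modulus \<open>2 * N\<close>.\<close>

lemma relpowp_mstep_CRM_covered:
  assumes par: "CRM_params (2 * N) (2 * b + 1)" and uv: "u < 2 * N" "v < 2 * N"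
    and z: "[int v = int u + int j + 2 * z] (mod int (2 * N))"
  shows "(mstep (CRM (2 * N) (2 * b + 1)) ^^ j) u v \<longleftrightarrow>
    covered N (int b) (if even u then (j + 1) div 2 else j div 2)
      (if even u then j div 2 else (j + 1) div 2) z"
proof -
  have "[int v = int u + int j - int p * (int (2 * b + 1) + 1) + int q * (int (2 * b + 1) - 1)]
      (mod int (2 * N)) \<longleftrightarrow> [z = int q * int b - int p * (int b + 1)] (mod int N)" for p q
  proof -
    have "[int v = int u + int j - int p * (int (2 * b + 1) + 1) + int q * (int (2 * b + 1) - 1)]
        (mod int (2 * N)) \<longleftrightarrow>
      [int v = (int u + int j) + 2 * (int q * int b - int p * (int b + 1))] (mod int (2 * N))"
      by (simp add: algebra_simps)
    also have "\<dots> \<longleftrightarrow> [(int u + int j) + 2 * z =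
        (int u + int j) + 2 * (int q * int b - int p * (int b + 1))] (mod int (2 * N))"
      using z by (meson cong_sym cong_trans)
    also have "\<dots> \<longleftrightarrow> [z = int q * int b - int p * (int b + 1)] (mod int N)"
      by (simp only: cong_add_lcancel of_nat_mult of_nat_numeral cong_double_iff)
    finally show ?thesis .
  qed
  then show ?thesis
    unfolding relpowp_mstep_CRM_iff[OF par uv] covered_def by simp
qed

text \<open>The rectangles in \<open>cov\<close> belong to walks of length \<open>k + 1\<close> from
  even and from odd vertices, the one in \<open>uncov\<close> to walks of length \<open>k\<close>
  from an even vertex. The parity of \<open>v - u\<close> selects \<open>k + 1\<close> or
  \<open>k + 2\<close> as the length, and the longer walk has a rectangle at least as large.\<close>

lemma mdiameter_CRM_eqI:
  assumes par: "CRM_params (2 * N) (2 * b + 1)"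
    and cov: "\<And>z. covered N (int b) ((k + 2) div 2) ((k + 1) div 2) z"
      "\<And>z. covered N (int b) ((k + 1) div 2) ((k + 2) div 2) z"
    and uncov: "\<not> covered N (int b) ((k + 1) div 2) (k div 2) z"
  shows "mdiameter (CRM (2 * N) (2 * b + 1)) = enat (k + 2)"
proof (rule antisym)
  let ?G = "CRM (2 * N) (2 * b + 1)"
  have N: "0 < N" using par by (simp add: CRM_params_def)
  have verts: "mverts ?G = {..<2 * N}" by (simp add: CRM_def)
  have "mdist ?G u v \<le> enat (k + 2)" if uv: "u < 2 * N" "v < 2 * N" for u v
  proof -
    define j where "j = (if even (int v - int u - int k) then k + 2 else k + 1)"
    have "even (int v - int u - int j)" by (auto simp: j_def)
    then obtain z where "int v - int u - int j = 2 * z" by blast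
    then have "[int v = int u + int j + 2 * z] (mod int (2 * N))" by (simp add: algebra_simps)
    moreover have "covered N (int b) (if even u then (j + 1) div 2 else j div 2)
        (if even u then j div 2 else (j + 1) div 2) z"
      by (cases "even u") (auto simp: j_def intro: covered_mono[OF cov(1)] covered_mono[OF cov(2)])
    ultimately have "(mstep ?G ^^ j) u v"
      using relpowp_mstep_CRM_covered[OF par uv] by blast
    then have "mdist ?G u v \<le> enat j"
      by (rule mdist_le_if_relpowp) (use uv N verts mstep_CRM_lt in auto)
    then show ?thesis by (rule order_trans) (simp add: j_def)
  qed
  then show "mdiameter ?G \<le> enat (k + 2)"
    unfolding mdiameter_def verts by (auto intro: SUP_least)
  \<comment> \<open>A walk of length \<open>k\<close> from 0 to this vertex would cover
    \<open>z\<close>.\<close>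
  define v where "v = nat ((int k + 2 * z) mod int (2 * N))"
  have v: "v < 2 * N" "[int v = int k + 2 * z] (mod int (2 * N))"
    using N by (auto simp: v_def nat_less_iff cong_def)
  have "\<not> (mstep ?G ^^ j) 0 v" if j: "j < k + 2" for j
  proof
    assume walk: "(mstep ?G ^^ j) 0 v"
    with relpowp_mstep_CRM_iff[OF par _ v(1), of 0 j] N obtain p q where
      "[int v = int j - int p * (int (2 * b + 1) + 1) + int q * (int (2 * b + 1) - 1)]
        (mod int (2 * N))" by auto
    \<comment> \<open>Modulo 2 only the lengths remain, which excludes a walk of length
      \<open>k + 1\<close>.\<close>
    then have "[int k + 2 * z = int j - int p * (int (2 * b + 1) + 1) + int q * (int (2 * b + 1) - 1)]
        (mod 2)"
      using v(2) by (metis cong_modulus_mult cong_sym cong_trans of_nat_mult of_nat_numeral)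
    then have "even k \<longleftrightarrow> even j"
      by (auto simp: cong_iff_dvd_diff)
    then obtain i where i: "k = j + 2 * i"
    proof -
      from \<open>even k \<longleftrightarrow> even j\<close> j have "j \<le> k"
        by (metis add_2_eq_Suc' even_Suc less_Suc_eq_le le_Suc_eq)
      with \<open>even k \<longleftrightarrow> even j\<close> have "even (k - j)" by simp
      then obtain i where "k - j = 2 * i" by blast
      with \<open>j \<le> k\<close> that[of i] show ?thesis by simp
    qed
    have "[int v = int 0 + int j + 2 * (z + int i)] (mod int (2 * N))"
      using v(2) by (simp add: i algebra_simps)
    from relpowp_mstep_CRM_covered[OF par _ v(1) this] walk N
    have "covered N (int b) ((j + 1) div 2) (j div 2) (z + int i)" by simp
    then obtain p q where pq: "p \<le> (j + 1) div 2" "q \<le> j div 2"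
      "[z + int i = int q * int b - int p * (int b + 1)] (mod int N)"
      by (auto simp: covered_def)
    \<comment> \<open>Going back and forth along a chord adds 2 to the length and 1 to each of
      \<open>p\<close> and \<open>q\<close>. Doing so \<open>i\<close> times turns the walk of
      length \<open>j\<close> into one of length \<open>k\<close> with the same end.\<close>
    have "covered N (int b) ((k + 1) div 2) (k div 2) z"
      unfolding covered_def
    proof (intro exI conjI)
      show "p + i \<le> (k + 1) div 2" "q + i \<le> k div 2" using pq i by auto
      show "[z = int (q + i) * int b - int (p + i) * (int b + 1)] (mod int N)"
        using pq(3) by (simp add: cong_iff_dvd_diff algebra_simps)
    qed
    with uncov show False by contradiction
  qed
  then have "enat (k + 2) \<le> mdist ?G 0 v" by (rule mdist_ge_if_not_relpowp)
  also have "\<dots> \<le> mdiameter ?G"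
    unfolding mdiameter_def using v(1) N verts by (intro SUP_upper2[where i = "(0, v)"]) auto
  finally show "enat (k + 2) \<le> mdiameter ?G" .
qed

text \<open>Multiplication by a unit permutes the residues, so \<open>b\<close> and
  \<open>- (b + 1)\<close> may be traded for the more convenient weights \<open>b'\<close> and
  \<open>a'\<close>.\<close>

lemma covered_iff_unit:
  assumes s: "coprime s (int N)" and b': "[s * b = b'] (mod int N)"
    and a': "[- (s * (b + 1)) = a'] (mod int N)"
  shows "covered N b x y z \<longleftrightarrow>
    (\<exists>p q. p \<le> x \<and> q \<le> y \<and> [s * z = int q * b' + int p * a'] (mod int N))"
proof -
  have "[z = int q * b - int p * (b + 1)] (mod int N) \<longleftrightarrow>
      [s * z = int q * b' + int p * a'] (mod int N)" for p q
  proof -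
    have "[z = int q * b - int p * (b + 1)] (mod int N) \<longleftrightarrow>
        [s * z = s * (int q * b - int p * (b + 1))] (mod int N)"
      using s by (simp only: cong_mult_lcancel)
    also have "s * (int q * b - int p * (b + 1)) = int q * (s * b) + int p * (- (s * (b + 1)))"
      by (simp add: algebra_simps)
    also have "[s * z = \<dots>] (mod int N) \<longleftrightarrow> [s * z = int q * b' + int p * a'] (mod int N)"
    proof -
      have "[int q * (s * b) + int p * (- (s * (b + 1))) = int q * b' + int p * a'] (mod int N)"
        using b' a' by (intro cong_add cong_mult cong_refl)
      then show ?thesis by (meson cong_sym cong_trans)
    qed
    finally show ?thesis .
  qed
  then show ?thesis by (simp only: covered_def)
qed

lemma not_dvd_if_between: "- n < d \<Longrightarrow> d < 0 \<Longrightarrow> \<not> n dvd d" for d n :: int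
  using zdvd_not_zless[of "- d" n] by auto

section \<open>Odd diameter: two digits in base \<open>l\<close>\<close>

lemma mdiameter_CRM_odd:
  assumes l: "2 \<le> l"
  shows "CRM_params (2 * l\<^sup>2) (2 * l - 1)" (is ?par)
    and "mdiameter (CRM (2 * l\<^sup>2) (2 * l - 1)) = enat (2 * l - 1)"
proof -
  define b where "b = l - 1"
  have b: "int b = int l - 1" "2 * l - 1 = 2 * b + 1" using l by (auto simp: b_def)
  have "2 * l \<le> l\<^sup>2" using l by (simp add: power2_eq_square)
  with l show ?par by (auto simp: CRM_params_def)
  then have par: "CRM_params (2 * l\<^sup>2) (2 * b + 1)" by (simp only: b)
  have disp: "int q * int b - int p * (int b + 1) = - int q + int l * (int q - int p)" for p q
    by (simp add: b algebra_simps)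
  have cov: "covered (l\<^sup>2) (int b) (l - 1) (l - 1) z" for z
  proof -
    \<comment> \<open>The digit \<open>q\<close> is forced modulo \<open>l\<close>, where the
      displacement is \<open>- q\<close>. The quotient \<open>w\<close> then asks for
      \<open>q - p\<close> to be \<open>- w\<close> modulo \<open>l\<close>, which gives
      \<open>p\<close>.\<close>
    define q where "q = nat ((- z) mod int l)"
    have q: "int q = (- z) mod int l" "q \<le> l - 1"
      using l by (auto simp: q_def nat_le_iff of_nat_diff)
    have "int l dvd - z - int q" unfolding q by (rule dvd_minus_mod)
    then obtain w where w: "- z - int q = int l * w" by blast
    define p where "p = nat ((int q + w) mod int l)"
    have p: "int p = (int q + w) mod int l" "p \<le> l - 1"
      using l by (auto simp: p_def nat_le_iff of_nat_diff)
    have "int l dvd int q + w - int p" unfolding p by (rule dvd_minus_mod)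
    then obtain r where r: "int q + w - int p = int l * r" by blast
    have "z - (- int q + int l * (int q - int p)) = - (int l * (w + int q - int p))"
      using w by (simp add: algebra_simps)
    also have "\<dots> = (int l)\<^sup>2 * (- r)"
      using r by (simp add: power2_eq_square add.commute)
    finally have "[z = - int q + int l * (int q - int p)] (mod int (l\<^sup>2))"
      by (simp only: cong_iff_dvd_diff of_nat_power dvd_triv_left)
    with p(2) q(2) show ?thesis
      unfolding covered_def disp by blast
  qed
  \<comment> \<open>Modulo \<open>l\<close> the value 1 requires \<open>q + 1\<close> to be
    divisible by \<open>l\<close>, so \<open>q\<close> is at least \<open>l - 1\<close>.\<close>
  have uncov: "\<not> covered (l\<^sup>2) (int b) (l - 1) (l - 2) 1"
  proof
    assume "covered (l\<^sup>2) (int b) (l - 1) (l - 2) 1"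
    then obtain p q where q: "q \<le> l - 2"
      and "[1 = - int q + int l * (int q - int p)] (mod (int l)\<^sup>2)"
      unfolding covered_def disp by auto
    then have "int l dvd 1 - (- int q + int l * (int q - int p))"
      by (auto simp: cong_iff_dvd_diff power2_eq_square elim: dvd_mult_left)
    then have "int l dvd 1 - (- int q + int l * (int q - int p)) + int l * (int q - int p)"
      by (rule dvd_add) simp
    moreover have "1 - (- int q + w) + w = int (q + 1)" for w by simp
    ultimately have "int l dvd int (q + 1)" by (simp only:)
    then have "l dvd q + 1" by (simp only: of_nat_dvd_iff)
    with q l show False by (auto dest: dvd_imp_le)
  qed
  \<comment> \<open>The parameter \<open>k\<close> of \<open>mdiameter_CRM_eqI\<close> is the
    diameter minus 2.\<close>
  have "mdiameter (CRM (2 * l\<^sup>2) (2 * b + 1)) = enat ((2 * l - 3) + 2)"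
  proof (rule mdiameter_CRM_eqI[OF par])
    have idx: "(2 * l - 3 + 2) div 2 = l - 1" "(2 * l - 3 + 1) div 2 = l - 1" "(2 * l - 3) div 2 = l - 2"
      using l by auto
    show "covered (l\<^sup>2) (int b) ((2 * l - 3 + 2) div 2) ((2 * l - 3 + 1) div 2) z"
      "covered (l\<^sup>2) (int b) ((2 * l - 3 + 1) div 2) ((2 * l - 3 + 2) div 2) z" for z
      using cov by (simp_all only: idx)
    show "\<not> covered (l\<^sup>2) (int b) ((2 * l - 3 + 1) div 2) ((2 * l - 3) div 2) 1"
      using uncov by (simp only: idx) simp
  qed
  moreover have "2 * l - 3 + 2 = 2 * b + 1" using l by (simp add: b_def)
  ultimately show "mdiameter (CRM (2 * l\<^sup>2) (2 * l - 1)) = enat (2 * l - 1)"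
    by (simp only: b(2))
qed

section \<open>Even diameter: moduli \<open>4 * t\<^sup>2 + 1\<close> and
  \<open>l * (l - 1) + 2\<close>\<close>

text \<open>In a walk of odd length \<open>2 * l - 1\<close> the parity of the start decides which
  count may reach \<open>l\<close>, hence two rectangles. Walks of length \<open>2 * l - 2\<close>
  give a square.\<close>

lemma mdiameter_CRM_evenI:
  assumes par: "CRM_params (2 * N) (2 * b + 1)" and l: "0 < l"
    and "\<And>z. covered N (int b) l (l - 1) z" "\<And>z. covered N (int b) (l - 1) l z"
    and "\<not> covered N (int b) (l - 1) (l - 1) z"
  shows "mdiameter (CRM (2 * N) (2 * b + 1)) = enat (2 * l)"
proof -
  have idx: "(2 * l - 2 + 2) div 2 = l" "(2 * l - 2 + 1) div 2 = l - 1" "(2 * l - 2) div 2 = l - 1"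
    using l by auto
  have "mdiameter (CRM (2 * N) (2 * b + 1)) = enat ((2 * l - 2) + 2)"
    by (rule mdiameter_CRM_eqI[OF par]; unfold idx; fact)
  with l show ?thesis by simp
qed

text \<open>Modulo \<open>4 * t\<^sup>2 + 1\<close>, multiplication by \<open>- (2 * t + 1)\<close> turns \<open>q * b - p * (b + 1)\<close> into \<open>p + 2 * t * q\<close>.\<close>

lemma mdiameter_CRM_even_unit_square:
  assumes t: "1 \<le> t"
  shows "CRM_params (2 * (4 * t\<^sup>2 + 1)) (2 * (t * (2 * t - 1)) + 1)" (is ?par)
    and "mdiameter (CRM (2 * (4 * t\<^sup>2 + 1)) (2 * (t * (2 * t - 1)) + 1)) = enat (4 * t)"
proof -
  define b where "b = t * (2 * t - 1)"
  define N where "N = 4 * t\<^sup>2 + 1"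
  define T where "T = int t"
  have T: "1 \<le> T" using t by (simp add: T_def)
  have b: "int b = T * (2 * T - 1)" using t by (simp add: b_def T_def of_nat_diff)
  have N: "int N = 4 * T\<^sup>2 + 1" by (simp add: N_def T_def)
  have "int b < int N" using T unfolding b N
    by (simp add: power2_eq_square algebra_simps add_pos_nonneg)
  then have par: "CRM_params (2 * N) (2 * b + 1)" by (auto simp: CRM_params_def)
  then show ?par by (simp only: b_def N_def)
  let ?s = "- (2 * T + 1)"
  have eqs: "?s * int b - 2 * T = int N * (- T)" "- (?s * (int b + 1)) - 1 = int N * T"
    unfolding b N by (simp_all add: algebra_simps power2_eq_square)
  then have congs: "[?s * int b = 2 * T] (mod int N)" "[- (?s * (int b + 1)) = 1] (mod int N)"
    by (metis cong_iff_dvd_diff dvd_triv_left)+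
  \<comment> \<open>So \<open>- (int b + 1)\<close> inverts \<open>?s\<close>; this also pulls the
    missing residue back below.\<close>
  have inv: "[?s * - (int b + 1) = 1] (mod int N)" using congs(2) by (simp only: mult_minus_right)
  then have "coprime ?s (int N)" using coprime_iff_invertible_int by blast
  note covered_iff = covered_iff_unit[OF this congs]
  \<comment> \<open>The residues up to \<open>4 * t\<^sup>2 - 1\<close> have two digits in base
    \<open>2 * t\<close>. Only the last residue, \<open>4 * t\<^sup>2\<close>, needs
    \<open>q = 2 * t\<close>, and then \<open>p = 0\<close>.\<close>
  have coords: "\<exists>p q. p < 2 * t \<and> q \<le> 2 * t \<and> (q = 2 * t \<longrightarrow> p = 0) \<and>
      [w = int q * (2 * T) + int p * 1] (mod int N)" for w
  proof -
    define r where "r = nat (w mod int N)"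
    have r: "int r = w mod int N" "r \<le> 2 * t * (2 * t)"
    proof -
      have "0 < N" by (simp add: N_def)
      then have "0 < int N" by (simp only: of_nat_0_less_iff)
      then show "int r = w mod int N" by (simp add: r_def)
      moreover have "w mod int N < int N" using \<open>0 < int N\<close> by simp
      ultimately have "r < N" by simp
      then show "r \<le> 2 * t * (2 * t)" by (simp add: N_def power2_eq_square)
    qed
    have "r div (2 * t) \<le> 2 * t * (2 * t) div (2 * t)" using r(2) by (rule div_le_mono)
    moreover have "r mod (2 * t) = 0" if "r div (2 * t) = 2 * t"
      using r(2) div_mult_mod_eq[of r "2 * t"] that by simp
    moreover have "int (r div (2 * t)) * (2 * T) + int (r mod (2 * t)) * 1 = int r"
    proof -
      have "int (r div (2 * t) * (2 * t) + r mod (2 * t)) = int r" by (simp only: div_mult_mod_eq)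
      then show ?thesis
        by (simp only: T_def of_nat_add of_nat_mult of_nat_numeral mult_1_right)
    qed
    moreover have "[w = int r] (mod int N)"
      unfolding r(1) by (simp only: cong_def mod_mod_trivial)
    moreover have "r mod (2 * t) < 2 * t" "2 * t * (2 * t) div (2 * t) = 2 * t"
      using t by simp_all
    ultimately show ?thesis
      by metis
  qed
  have "mdiameter (CRM (2 * N) (2 * b + 1)) = enat (2 * (2 * t))"
  proof (rule mdiameter_CRM_evenI[OF par])
    show "0 < 2 * t" using t by simp
  next
    fix z
    obtain p q where pq: "p < 2 * t" "q \<le> 2 * t" "q = 2 * t \<Longrightarrow> p = 0"
      "[?s * z = int q * (2 * T) + int p * 1] (mod int N)"
      using coords by blast
    then show "covered N (int b) (2 * t - 1) (2 * t) z"
      unfolding covered_iff using t by (intro exI[of _ p] exI[of _ q]) auto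
    show "covered N (int b) (2 * t) (2 * t - 1) z"
    proof (cases "q = 2 * t")
      case True
      \<comment> \<open>If \<open>q\<close> may not reach \<open>2 * t\<close>, one unit of
        \<open>q\<close> is exchanged for \<open>2 * t\<close> units of \<open>p\<close>.\<close>
      have "int (2 * t - 1) * (2 * T) + int (2 * t) * 1 = int q * (2 * T) + int p * 1"
        using True pq t by (simp add: T_def of_nat_diff algebra_simps)
      with pq(4) show ?thesis
        unfolding covered_iff by (intro exI[of _ "2 * t"] exI[of _ "2 * t - 1"]) simp
    next
      case False
      with pq show ?thesis
        unfolding covered_iff by (intro exI[of _ p] exI[of _ q]) auto
    qed
  next
    \<comment> \<open>The missing residue is \<open>4 * t\<^sup>2\<close>, one more than the largest
      value on the square; the difference lies strictly between \<open>- N\<close> and 0.\<close>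
    show "\<not> covered N (int b) (2 * t - 1) (2 * t - 1) (- (int b + 1) * (4 * T\<^sup>2))"
    proof
      assume "covered N (int b) (2 * t - 1) (2 * t - 1) (- (int b + 1) * (4 * T\<^sup>2))"
      then obtain p q where pq: "p \<le> 2 * t - 1" "q \<le> 2 * t - 1"
        "[?s * (- (int b + 1) * (4 * T\<^sup>2)) = int q * (2 * T) + int p * 1] (mod int N)"
        unfolding covered_iff by blast
      have "[?s * - (int b + 1) * (4 * T\<^sup>2) = 1 * (4 * T\<^sup>2)] (mod int N)"
        using inv by (rule cong_mult) (rule cong_refl)
      with pq(3) have "[int q * (2 * T) + int p = 4 * T\<^sup>2] (mod int N)"
        by (metis (no_types, lifting) cong_sym cong_trans mult.assoc mult.left_neutral mult.right_neutral)
      then have "int N dvd int q * (2 * T) + int p - 4 * T\<^sup>2"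
        by (simp add: cong_iff_dvd_diff)
      moreover have "int q * (2 * T) + int p - 4 * T\<^sup>2 < 0"
      proof -
        have pq': "int p \<le> 2 * T - 1" "int q \<le> 2 * T - 1" using pq t by (auto simp: T_def)
        have "int q * (2 * T) \<le> (2 * T - 1) * (2 * T)" using pq' T by (intro mult_right_mono) auto
        with pq' show ?thesis by (simp add: power2_eq_square algebra_simps)
      qed
      moreover have "0 \<le> int q * (2 * T)" using T by simp
      then have "- int N < int q * (2 * T) + int p - 4 * T\<^sup>2"
        unfolding N by linarith
      ultimately show False using not_dvd_if_between by blast
    qed
  qed
  then show "mdiameter (CRM (2 * (4 * t\<^sup>2 + 1)) (2 * (t * (2 * t - 1)) + 1)) = enat (4 * t)"
    by (simp add: b_def N_def)
qed

text \<open>Multiplication by \<open>l - 2\<close> turns \<open>q * b - p * (b + 1)\<close> into \<open>q - (l - 1) * p\<close>; for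
  \<open>p, q \<le> l - 1\<close> these values are the \<open>N - 1\<close> consecutive integers from \<open>- (l - 1)\<^sup>2\<close> to \<open>l - 1\<close>.\<close>

lemma mdiameter_CRM_even_pronic:
  assumes l: "2 \<le> l" and bN: "b < N" and N_def: "N = l * (l - 1) + 2"
    and inv: "[int b * (int l - 2) = 1] (mod int N)"
  shows "mdiameter (CRM (2 * N) (2 * b + 1)) = enat (2 * l)"
proof -
  define L where "L = int l"
  have L: "2 \<le> L" using l by (simp add: L_def)
  have N: "int N = L * (L - 1) + 2" using l by (simp add: N_def L_def of_nat_diff)
  have par: "CRM_params (2 * N) (2 * b + 1)"
    using bN by (auto simp: CRM_params_def N_def)
  have inv': "[(L - 2) * int b = 1] (mod int N)"
    using inv by (simp add: L_def mult.commute)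
  have "[- ((L - 2) * int b + (L - 2)) = - (1 + (L - 2))] (mod int N)"
    using inv' by (simp only: cong_minus_minus_iff cong_add_rcancel)
  then have inv2: "[- ((L - 2) * (int b + 1)) = - (L - 1)] (mod int N)"
    by (simp add: algebra_simps)
  have "coprime (L - 2) (int N)" using inv' coprime_iff_invertible_int by blast
  note covered_iff = covered_iff_unit[OF this inv' inv2]
  \<comment> \<open>The sign is reversed, so that a residue \<open>r\<close> from 0 to
    \<open>N - 1\<close> is to be written as \<open>(L - 1) * p - q\<close>.\<close>
  have coveredI: "covered N (int b) x y z"
    if "0 \<le> p" "p \<le> int x" "0 \<le> q" "q \<le> int y" "int N dvd (L - 1) * p - q - (- ((L - 2) * z)) mod int N"
    for x y z p q
  proof -
    have "int N dvd (- ((L - 2) * z)) mod int N - (- ((L - 2) * z))"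
      by (metis cong_iff_dvd_diff cong_mod_left cong_refl)
    with that(5) have "int N dvd ((L - 1) * p - q - (- ((L - 2) * z)) mod int N) +
        ((- ((L - 2) * z)) mod int N - (- ((L - 2) * z)))"
      by (rule dvd_add)
    then have "[(L - 2) * z = q * 1 + p * - (L - 1)] (mod int N)"
      by (simp add: cong_iff_dvd_diff algebra_simps)
    with that(1-4) show ?thesis
      unfolding covered_iff by (intro exI[of _ "nat p"] exI[of _ "nat q"]) auto
  qed
  show ?thesis
  proof (rule mdiameter_CRM_evenI[OF par])
    show "0 < l" using l by simp
  next
    fix z
    define r where "r = (- ((L - 2) * z)) mod int N"
    have r: "0 \<le> r" "r < int N" using L by (simp_all add: r_def N add_nonneg_pos)
    \<comment> \<open>\<open>p\<close> is \<open>r / (L - 1)\<close> rounded up, and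
      \<open>q\<close> is the excess of \<open>(L - 1) * p\<close> over \<open>r\<close>.\<close>
    define p where "p = (r + (L - 2)) div (L - 1)"
    define q where "q = (L - 2) - (r + (L - 2)) mod (L - 1)"
    have "0 \<le> (r + (L - 2)) mod (L - 1)" "(r + (L - 2)) mod (L - 1) < L - 1"
      using L by (auto intro: pos_mod_sign pos_mod_bound)
    then have q: "0 \<le> q" "q \<le> L - 2"
      unfolding q_def by linarith+
    have p0: "0 \<le> p" using L r by (simp add: p_def pos_imp_zdiv_nonneg_iff)
    have pqr: "(L - 1) * p - q = r"
      using mult_div_mod_eq[of "L - 1" "r + (L - 2)"] unfolding p_def q_def by linarith
    have p_le: "p \<le> m" if "r \<le> (L - 1) * m" for m
    proof -
      have "(L - 1) * p < (L - 1) * (m + 1)" using that pqr q by (simp add: algebra_simps)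
      then show ?thesis using L by (simp add: mult_less_cancel_left)
    qed
    show "covered N (int b) l (l - 1) z"
    proof (cases "r \<le> (L - 1) * L")
      case True
      with p0 p_le q L pqr show ?thesis
        by (intro coveredI[of p _ q]) (auto simp: L_def r_def of_nat_diff)
    next
      case False
      \<comment> \<open>The only residue above \<open>(L - 1) * L\<close> is -1, given by
        \<open>p = 0\<close> and \<open>q = 1\<close>.\<close>
      with r have "r = int N - 1" by (simp add: N algebra_simps)
      with L show ?thesis
        by (intro coveredI[of 0 _ 1]) (auto simp: L_def r_def of_nat_diff)
    qed
    show "covered N (int b) (l - 1) l z"
    proof (cases "r \<le> (L - 1) * (L - 1)")
      case True
      have "p \<le> int (l - 1)" using p_le[OF True] l by (simp add: L_def of_nat_diff)
      with p0 q pqr show ?thesis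
        by (intro coveredI[of p _ q]) (auto simp: L_def r_def)
    next
      case False
      \<comment> \<open>Beyond \<open>(L - 1)\<^sup>2\<close> the residue is reached from above:
        \<open>r\<close> is congruent to \<open>- (N - r)\<close>, and \<open>N - r\<close> is at
        most \<open>l\<close>.\<close>
      with r have "0 \<le> int N - r" "int N - r \<le> int l" by (auto simp: N algebra_simps L_def)
      with L show ?thesis
        by (intro coveredI[of 0 _ "int N - r"]) (auto simp: r_def)
    qed
  next
    \<comment> \<open>Since \<open>b\<close> inverts \<open>L - 2\<close>, this element becomes
      \<open>L\<close>, the one residue left out by the \<open>N - 1\<close> consecutive values on
      the square.\<close>
    show "\<not> covered N (int b) (l - 1) (l - 1) (int b * L)"
    proof
      assume "covered N (int b) (l - 1) (l - 1) (int b * L)"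
      then obtain p q where pq: "p \<le> l - 1" "q \<le> l - 1"
        "[(L - 2) * (int b * L) = int q * 1 + int p * - (L - 1)] (mod int N)"
        unfolding covered_iff by blast
      have "[(L - 2) * int b * L = 1 * L] (mod int N)"
        using inv' by (rule cong_mult) (rule cong_refl)
      with pq(3) have "[int q * 1 + int p * - (L - 1) = L] (mod int N)"
        by (metis (no_types, lifting) cong_sym cong_trans mult.assoc mult.left_neutral)
      then have "int N dvd int q - int p * (L - 1) - L"
        by (simp only: cong_iff_dvd_diff mult_1_right mult_minus_right add_uminus_conv_diff)
      moreover have pq': "int p \<le> L - 1" "int q \<le> L - 1" using pq l by (auto simp: L_def)
      have "int p * (L - 1) \<le> (L - 1) * (L - 1)" using pq' L by (intro mult_right_mono) auto
      then have "- int N < int q - int p * (L - 1) - L"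
        by (simp add: N algebra_simps)
      moreover have "int q - int p * (L - 1) - L < 0"
        using pq' L by (smt (verit) mult_nonneg_nonneg of_nat_0_le_iff)
      ultimately show False using not_dvd_if_between by blast
    qed
  qed
qed

section \<open>The parameters of the families\<close>

lemma morder_CRM: "morder (CRM n c) = n"
  by (simp add: morder_def CRM_def)

lemma mdiameter_CRM_6_mod_8:
  fixes t :: nat
  assumes "1 \<le> t"
  defines "n \<equiv> 2 * (4 * t - 1) * (4 * t - 2) + 4" and "c \<equiv> 2 * (2 * t - 1)\<^sup>2 + 1"
  shows "CRM_params n c" "mdiameter (CRM n c) = enat (8 * t - 2)"
proof -
  \<comment> \<open>The shift by 1 turns every formula into a polynomial with nonnegative
    coefficients, free of truncated subtraction.\<close>
  define s where "s = t - 1"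
  have t: "t = s + 1" using assms(1) by (simp add: s_def)
  define l where "l = 4 * s + 3"
  define b where "b = (2 * s + 1)\<^sup>2"
  define N where "N = l * (l - 1) + 2"
  have nc: "n = 2 * N" "c = 2 * b + 1" "8 * t - 2 = 2 * l"
    by (simp_all add: n_def c_def N_def b_def l_def t algebra_simps)
  have bN: "b < N" by (simp add: b_def N_def l_def power2_eq_square algebra_simps)
  then show "CRM_params n c" by (auto simp: nc CRM_params_def N_def)
  have "int b * (int l - 2) - 1 = int N * int s"
    by (simp add: b_def N_def l_def power2_eq_square algebra_simps)
  then have "[int b * (int l - 2) = 1] (mod int N)" by (simp add: cong_iff_dvd_diff)
  with bN N_def show "mdiameter (CRM n c) = enat (8 * t - 2)"
    unfolding nc by (intro mdiameter_CRM_even_pronic) (simp_all add: l_def)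
qed

lemma mdiameter_CRM_2_mod_8:
  fixes t :: nat
  assumes "2 \<le> t"
  defines "n \<equiv> 2 * (4 * t - 3) * (4 * t - 4) + 4" and "c \<equiv> 24 * t\<^sup>2 + 23 - 44 * t"
  shows "CRM_params n c" "mdiameter (CRM n c) = enat (8 * t - 6)"
proof -
  define s where "s = t - 2"
  have t: "t = s + 2" using assms(1) by (simp add: s_def)
  define l where "l = 4 * s + 5"
  define b where "b = 12 * s\<^sup>2 + 26 * s + 15"
  define N where "N = l * (l - 1) + 2"
  have nc: "n = 2 * N" "c = 2 * b + 1" "8 * t - 6 = 2 * l"
    by (simp_all add: n_def c_def N_def b_def l_def t power2_eq_square algebra_simps)
  have bN: "b < N" by (simp add: b_def N_def l_def power2_eq_square algebra_simps)
  then show "CRM_params n c" by (auto simp: nc CRM_params_def N_def)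
  \<comment> \<open>The explicit quotient shows that \<open>b\<close> inverts \<open>l - 2\<close>
    modulo \<open>N\<close>.\<close>
  have "int b * (int l - 2) - 1 = int N * (3 * int s + 2)"
    by (simp add: b_def N_def l_def power2_eq_square algebra_simps)
  then have "[int b * (int l - 2) = 1] (mod int N)" by (simp add: cong_iff_dvd_diff)
  with bN N_def show "mdiameter (CRM n c) = enat (8 * t - 6)"
    unfolding nc by (intro mdiameter_CRM_even_pronic) (simp_all add: l_def)
qed

theorem theorem4p2:
  shows
   "(\<forall>k l :: nat. odd k \<and> k = 2 * l - 1 \<and> l \<ge> 2 \<longrightarrow>
      (\<exists>n c. CRM_params n c \<and> mdiameter (CRM n c) = enat k \<and>
        morder (CRM n c) = n \<and>
        real n = 2 * real l ^ 2 \<and> real n = 1/2 * (real k + 1) ^ 2 \<and>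
        real c = 2 * real l - 1 \<and> real c = real k)) \<and>
    (\<forall>k l t :: nat. even k \<and> k mod 4 = 0 \<and> k = 2 * l \<and> k = 4 * t \<and> t \<ge> 1 \<longrightarrow>
      (\<exists>n c. CRM_params n c \<and> mdiameter (CRM n c) = enat k \<and>
        morder (CRM n c) = n \<and>
        real n = 8 * real t ^ 2 + 2 \<and> real n = 1/2 * real k ^ 2 + 2 \<and>
        real c = (2 * real t - 1) ^ 2 + 2 * real t \<and>
        real c = (real k / 2 - 1) ^ 2 + real k / 2)) \<and>
    (\<forall>k l t :: nat. even k \<and> k mod 8 = 6 \<and> k = 2 * l \<and> k = 8 * t - 2 \<and> t \<ge> 1 \<longrightarrow>
      (\<exists>n c. CRM_params n c \<and> mdiameter (CRM n c) = enat k \<and>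
        morder (CRM n c) = n \<and>
        real n = 2 * (4 * real t - 1) * (4 * real t - 2) + 4 \<and>
        real n = real k * (real k / 2 - 1) + 4 \<and>
        real c = 8 * real t ^ 2 - 8 * real t + 3 \<and>
        real c = 1/8 * (real k + 2) ^ 2 - real k + 1)) \<and>
    (\<forall>k l t :: nat. even k \<and> k mod 8 = 2 \<and> k = 2 * l \<and> k = 8 * t - 6 \<and> t \<ge> 2 \<longrightarrow>
      (\<exists>n c. CRM_params n c \<and> mdiameter (CRM n c) = enat k \<and>
        morder (CRM n c) = n \<and>
        real n = 2 * (4 * real t - 3) * (4 * real t - 4) + 4 \<and>
        real n = real k * (real k / 2 - 1) + 4 \<and>
        real c = 24 * real t ^ 2 - 44 * real t + 23 \<and>
        real c = 3/8 * (real k + 6) ^ 2 - 11/2 * real k - 10))"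
proof (intro conjI allI impI; elim conjE)
  fix k l :: nat
  assume kl: "k = 2 * l - 1" "2 \<le> l"
  then show "\<exists>n c. CRM_params n c \<and> mdiameter (CRM n c) = enat k \<and>
        morder (CRM n c) = n \<and>
        real n = 2 * real l ^ 2 \<and> real n = 1/2 * (real k + 1) ^ 2 \<and>
        real c = 2 * real l - 1 \<and> real c = real k"
    using mdiameter_CRM_odd[of l]
    by - (rule exI[of _ "2 * l\<^sup>2"], rule exI[of _ "2 * l - 1"],
      simp add: morder_CRM of_nat_diff power2_eq_square)
next
  fix k l t :: nat
  assume t: "k = 4 * t" "1 \<le> t"
  let ?n = "2 * (4 * t\<^sup>2 + 1)" and ?c = "2 * (t * (2 * t - 1)) + 1"
  have "real ?n = 8 * real t ^ 2 + 2" "real ?c = (2 * real t - 1) ^ 2 + 2 * real t"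
    using t(2) by (simp_all add: of_nat_diff power2_eq_square algebra_simps)
  with t show "\<exists>n c. CRM_params n c \<and> mdiameter (CRM n c) = enat k \<and>
        morder (CRM n c) = n \<and>
        real n = 8 * real t ^ 2 + 2 \<and> real n = 1/2 * real k ^ 2 + 2 \<and>
        real c = (2 * real t - 1) ^ 2 + 2 * real t \<and>
        real c = (real k / 2 - 1) ^ 2 + real k / 2"
    using mdiameter_CRM_even_unit_square[OF t(2)]
    by - (rule exI[of _ ?n], rule exI[of _ ?c], simp add: morder_CRM power2_eq_square)
next
  fix k l t :: nat
  assume t: "k = 8 * t - 2" "1 \<le> t"
  let ?n = "2 * (4 * t - 1) * (4 * t - 2) + 4" and ?c = "2 * (2 * t - 1)\<^sup>2 + 1"
  have k: "real k = 8 * real t - 2" using t by (simp add: of_nat_diff)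
  have nc: "real ?n = 2 * (4 * real t - 1) * (4 * real t - 2) + 4"
    "real ?c = 8 * real t ^ 2 - 8 * real t + 3"
  proof -
    have diffs: "real (4 * t - 1) = 4 * real t - 1" "real (4 * t - 2) = 4 * real t - 2"
      "real (2 * t - 1) = 2 * real t - 1"
      using t(2) by (simp_all add: of_nat_diff)
    show "real ?n = 2 * (4 * real t - 1) * (4 * real t - 2) + 4"
      by (simp only: of_nat_add of_nat_mult of_nat_numeral diffs)
    show "real ?c = 8 * real t ^ 2 - 8 * real t + 3"
      unfolding of_nat_add of_nat_mult of_nat_power diffs
      by (simp add: power2_eq_square algebra_simps)
  qed
  show "\<exists>n c. CRM_params n c \<and> mdiameter (CRM n c) = enat k \<and>
        morder (CRM n c) = n \<and>
        real n = 2 * (4 * real t - 1) * (4 * real t - 2) + 4 \<and>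
        real n = real k * (real k / 2 - 1) + 4 \<and>
        real c = 8 * real t ^ 2 - 8 * real t + 3 \<and>
        real c = 1/8 * (real k + 2) ^ 2 - real k + 1"
  proof (rule exI[of _ ?n], rule exI[of _ ?c], intro conjI)
    show "CRM_params ?n ?c" "mdiameter (CRM ?n ?c) = enat k"
      using mdiameter_CRM_6_mod_8[OF t(2)] t(1) by simp_all
    show "morder (CRM ?n ?c) = ?n" by (rule morder_CRM)
  qed (unfold nc k, simp_all add: power2_eq_square field_simps)
next
  fix k l t :: nat
  assume t: "k = 8 * t - 6" "2 \<le> t"
  let ?n = "2 * (4 * t - 3) * (4 * t - 4) + 4" and ?c = "24 * t\<^sup>2 + 23 - 44 * t"
  have k: "real k = 8 * real t - 6" using t by (simp add: of_nat_diff)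
  have "44 * t \<le> 24 * t\<^sup>2" using t(2) by (simp add: power2_eq_square)
  then have nc: "real ?n = 2 * (4 * real t - 3) * (4 * real t - 4) + 4"
    "real ?c = 24 * real t ^ 2 - 44 * real t + 23"
    using t(2) by (simp_all add: of_nat_diff)
  show "\<exists>n c. CRM_params n c \<and> mdiameter (CRM n c) = enat k \<and>
        morder (CRM n c) = n \<and>
        real n = 2 * (4 * real t - 3) * (4 * real t - 4) + 4 \<and>
        real n = real k * (real k / 2 - 1) + 4 \<and>
        real c = 24 * real t ^ 2 - 44 * real t + 23 \<and>
        real c = 3/8 * (real k + 6) ^ 2 - 11/2 * real k - 10"
  proof (rule exI[of _ ?n], rule exI[of _ ?c], intro conjI)
    show "CRM_params ?n ?c" "mdiameter (CRM ?n ?c) = enat k"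
      using mdiameter_CRM_2_mod_8[OF t(2)] t(1) by simp_all
    show "morder (CRM ?n ?c) = ?n" by (rule morder_CRM)
  qed (unfold nc k, simp_all add: power2_eq_square field_simps)
qed

end
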